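(* Let $\theta\in\mathbb R\setminus\{0\}$, let $X_1,\dots,X_n\in\mathcal D$ be real random variables, let $p_1,\dots,p_n>0$ with $\sum_kp_k=1$, and let $X$ be drawn from the mixture $(p_k,X_k)_{k=1}^n$. Suppose that $\varphi_{X_k}=o(\varphi_{X_1})$ at $\infty$ for every $k>1$. Then $$l^\theta(wX)-l^\theta(wX_1)\longrightarrow-\frac{2}{\theta^2}\ln p_1\qquad\text{as } w\to\infty.$$
   Context: $\mathcal D$ denotes the class of (one- or multi-dimensional) random variables with strictly positive-definite Lebesgue density, together with the limiting case of an atom at $0$; their characteristic functions $\varphi_X(\theta)=\mathbb E[e^{i\theta X}]$ are real-valued, even and strictly positive. $l^\theta(X):=-\frac{2}{\theta^2}\ln\mathbb E[e^{i\theta X}]$. "$X$ is drawn from the mixture $(p_k,X_k)_{k=1}^n$" means that the law of $X$ is $\sum_k p_k\,\mathrm{Law}(X_k)$, so $\varphi_X=\sum_k p_k\varphi_{X_k}$. *)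

theory Defs
  imports "HOL-Probability.Probability" "HOL-Library.Landau_Symbols"
begin

text \<open>The finite set \<open>S\<close> plays the role of a list of pairwise distinct points, and coefficients that
  vanish on \<open>S\<close> are excluded. With complex coefficients a positive-definite function is
  automatically Hermitian, so a real-valued one is even.\<close>

definition strictly_positive_definite :: "(real \<Rightarrow> complex) \<Rightarrow> bool" where
  "strictly_positive_definite f \<longleftrightarrow>
     (\<forall>S c. finite S \<longrightarrow> (\<exists>x\<in>S. c x \<noteq> 0) \<longrightarrow>
        (\<Sum>x\<in>S. \<Sum>y\<in>S. c x * cnj (c y) * f (x - y)) \<in> complex_of_real ` {0<..})"

definition char_fn :: "'a measure \<Rightarrow> ('a \<Rightarrow> real) \<Rightarrow> real \<Rightarrow> complex" where
  "char_fn M X = char (distr M borel X)"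

text \<open>The quadratic-form condition on the density only gives a nonnegative characteristic function:
  the triangular function \<open>max 0 (1 - \<bar>t\<bar>)\<close> is the characteristic function of a strictly
  positive-definite density but has zeros. Strict positivity of the characteristic function, part
  of the intended class, is therefore required explicitly. In the case of an atom at \<open>0\<close> the
  characteristic function is constantly \<open>1\<close>.\<close>

definition class_D :: "'a measure \<Rightarrow> ('a \<Rightarrow> real) \<Rightarrow> bool" where
  "class_D M X \<longleftrightarrow> prob_space M \<and> X \<in> borel_measurable M \<and>
     ((\<exists>f. (\<forall>x. 0 \<le> f x) \<and> distributed M lborel X (\<lambda>x. ennreal (f x)) \<and>
           strictly_positive_definite (\<lambda>x. complex_of_real (f x)) \<and>
           (\<forall>t. char_fn M X t \<in> complex_of_real ` {0<..}))
      \<or> (AE \<omega> in M. X \<omega> = 0))"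

text \<open>\<open>drawn_from_mixture I p M X N Y\<close>: the random variable \<open>Y\<close> on \<open>N\<close> is drawn from the mixture
  \<open>(p k, X k)\<close>, \<open>k \<in> I\<close>, where \<open>X k\<close> lives on \<open>M k\<close>.\<close>

definition drawn_from_mixture ::
  "nat set \<Rightarrow> (nat \<Rightarrow> real) \<Rightarrow> (nat \<Rightarrow> 'a measure) \<Rightarrow> (nat \<Rightarrow> 'a \<Rightarrow> real) \<Rightarrow> 'b measure \<Rightarrow> ('b \<Rightarrow> real) \<Rightarrow> bool"
  where
  "drawn_from_mixture I p M X N Y \<longleftrightarrow> prob_space N \<and> Y \<in> borel_measurable N \<and>
     (\<forall>A\<in>sets borel. measure (distr N borel Y) A = (\<Sum>k\<in>I. p k * measure (distr (M k) borel (X k)) A))"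

text \<open>For variables in the class above and for their mixtures the characteristic function takes
  positive real values, so \<open>Re\<close> merely changes the type.\<close>

definition log_char :: "real \<Rightarrow> 'a measure \<Rightarrow> ('a \<Rightarrow> real) \<Rightarrow> real" where
  "log_char \<theta> M X = - (2 / \<theta>\<^sup>2) * ln (Re (char_fn M X \<theta>))"

lemma char_fn_eq_expectation:
  assumes "X \<in> borel_measurable M"
  shows "char_fn M X t = (CLINT \<omega>|M. exp (\<i> * complex_of_real (t * X \<omega>)))"
  using assms by (simp add: char_fn_def char_def integral_distr)

lemma class_D_char_fn_pos:
  assumes "class_D M X"
  shows "char_fn M X t \<in> complex_of_real ` {0<..}"
proof -
  interpret prob_space M using assms by (simp add: class_D_def)
  have X[measurable]: "X \<in> borel_measurable M" using assms by (simp add: class_D_def)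
  show ?thesis
  proof (cases "AE \<omega> in M. X \<omega> = 0")
    case True
    then have "char_fn M X t = (CLINT \<omega>|M. 1)"
      unfolding char_fn_eq_expectation[OF X] by (intro integral_cong_AE) auto
    then show ?thesis by (auto simp: prob_space intro!: image_eqI[of _ _ 1])
  next
    case False
    then show ?thesis using assms by (auto simp: class_D_def)
  qed
qed

end

theory Submission
  imports Defs
begin

text \<open>The characteristic function of the mixture is \<open>\<Sum>k. p k * \<phi> k\<close>, so its quotient by \<open>\<phi> 1\<close> tends to
  \<open>p 1\<close>; the claim is the logarithm of this limit, evaluated at \<open>\<bar>\<theta>\<bar> * w\<close>. Mixture linearity for the
  real part is obtained from nonnegative integrals by integrating \<open>1 + cos (t * x) \<ge> 0\<close>.\<close>

text \<open>Both sides are additive, homogeneous and continuous along increasing sequences in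
  \<open>f\<close>, and they agree on indicators by \<open>em\<close>; induction over measurable
  functions does the rest. Working in \<open>ennreal\<close> avoids all integrability side
  conditions.\<close>

lemma nn_integral_mixture:
  fixes c :: "'i \<Rightarrow> ennreal" and f :: "'a \<Rightarrow> ennreal"
  assumes sets_eq: "\<And>k. k \<in> I \<Longrightarrow> sets (\<nu> k) = sets \<mu>"
    and em: "\<And>A. A \<in> sets \<mu> \<Longrightarrow> emeasure \<mu> A = (\<Sum>k\<in>I. c k * emeasure (\<nu> k) A)"
    and "f \<in> borel_measurable \<mu>"
  shows "(\<integral>\<^sup>+x. f x \<partial>\<mu>) = (\<Sum>k\<in>I. c k * (\<integral>\<^sup>+x. f x \<partial>\<nu> k))"
  using assms(3)
proof (induction rule: borel_measurable_induct)
  case (cong f g)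
  have "(\<integral>\<^sup>+x. f x \<partial>\<nu> k) = (\<integral>\<^sup>+x. g x \<partial>\<nu> k)" if "k \<in> I" for k
    using cong(3) sets_eq_imp_space_eq[OF sets_eq[OF that]] by (intro nn_integral_cong) auto
  moreover have "(\<integral>\<^sup>+x. f x \<partial>\<mu>) = (\<integral>\<^sup>+x. g x \<partial>\<mu>)"
    using cong(3) by (intro nn_integral_cong) auto
  ultimately show ?case using cong(4) by simp
next
  case (set A)
  then show ?case by (simp add: em sets_eq)
next
  case (mult u a)
  have "u \<in> borel_measurable (\<nu> k)" if "k \<in> I" for k
    using mult(2) measurable_cong_sets[OF sets_eq[OF that] refl] by auto
  then show ?case
    using mult by (simp add: nn_integral_cmult sum_distrib_left mult.left_commute)
next
  case (add u v)
  have "u \<in> borel_measurable (\<nu> k)" "v \<in> borel_measurable (\<nu> k)" if "k \<in> I" for k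
    using add(1,3) measurable_cong_sets[OF sets_eq[OF that] refl] by auto
  then show ?case
    using add by (simp add: nn_integral_add sum.distrib distrib_left)
next
  case (seq U)
  have meas: "U i \<in> borel_measurable (\<nu> k)" if "k \<in> I" for i k
    using seq(1) measurable_cong_sets[OF sets_eq[OF that] refl] by auto
  \<comment> \<open>Monotonicity in \<open>i\<close> is what allows the supremum to be exchanged
    with the sum over \<open>k\<close> below.\<close>
  have mono: "incseq (\<lambda>i. c k * (\<integral>\<^sup>+x. U i x \<partial>\<nu> k))" for k
    using seq(3) by (intro monoI mult_left_mono nn_integral_mono) (auto simp: mono_def le_fun_def)
  have "(\<integral>\<^sup>+x. (SUP i. U i) x \<partial>\<mu>) = (SUP i. \<integral>\<^sup>+x. U i x \<partial>\<mu>)"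
    using seq by (simp add: SUP_apply image_comp nn_integral_monotone_convergence_SUP)
  also have "\<dots> = (SUP i. \<Sum>k\<in>I. c k * (\<integral>\<^sup>+x. U i x \<partial>\<nu> k))"
    using seq by simp
  also have "\<dots> = (\<Sum>k\<in>I. SUP i. c k * (\<integral>\<^sup>+x. U i x \<partial>\<nu> k))"
    by (intro ennreal_SUP_sum mono)
  also have "\<dots> = (\<Sum>k\<in>I. c k * (\<integral>\<^sup>+x. (SUP i. U i) x \<partial>\<nu> k))"
    using seq(3) meas
    by (intro sum.cong)
      (auto simp: SUP_apply image_comp SUP_mult_left_ennreal nn_integral_monotone_convergence_SUP)
  finally show ?case .
qed

lemma Re_char_fn:
  assumes "prob_space M" "X \<in> borel_measurable M"
  shows "Re (char_fn M X t) = (\<integral>x. cos (t * x) \<partial>distr M borel X)"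
proof -
  interpret real_distribution "distr M borel X"
    using assms by (intro prob_space.real_distribution_distr) auto
  have "complex_integrable (distr M borel X) (\<lambda>x. iexp (t * x))"
    by (rule integrable_iexp) auto
  from integral_Re[OF this] show ?thesis
    by (simp add: char_fn_def char_def Re_exp)
qed

text \<open>Since the law has mass 1, adding the constant 1 to the cosine shifts its integral by
  exactly 1. The nonnegativity part makes it possible to return from \<open>ennreal\<close> to the
  reals later.\<close>

lemma
  assumes "prob_space M" "X \<in> borel_measurable M"
  shows one_plus_Re_char_fn_nonneg: "0 \<le> 1 + Re (char_fn M X t)"
    and nn_integral_one_plus_cos:
      "(\<integral>\<^sup>+x. ennreal (1 + cos (t * x)) \<partial>distr M borel X) = ennreal (1 + Re (char_fn M X t))"
proof -
  interpret real_distribution "distr M borel X"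
    using assms by (intro prob_space.real_distribution_distr) auto
  have int: "integrable (distr M borel X) (\<lambda>x. cos (t * x))"
    by (rule integrable_const_bound[where B = 1]) auto
  have nonneg: "0 \<le> 1 + cos (t * x)" for x
    using cos_ge_minus_one[of "t * x"] by linarith
  have eq: "(\<integral>x. 1 + cos (t * x) \<partial>distr M borel X) = 1 + Re (char_fn M X t)"
    using int prob_space by (simp add: Re_char_fn assms)
  show "0 \<le> 1 + Re (char_fn M X t)"
    unfolding eq[symmetric] using nonneg by (intro integral_nonneg_AE) auto
  show "(\<integral>\<^sup>+x. ennreal (1 + cos (t * x)) \<partial>distr M borel X) = ennreal (1 + Re (char_fn M X t))"
    unfolding eq[symmetric] using int nonneg by (intro nn_integral_eq_integral) auto
qed

text \<open>The mixture identity for sets extends to nonnegative integrands, here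
  \<open>1 + cos (t * x)\<close>; the added constants cancel because the weights sum to 1.\<close>

lemma Re_char_fn_mixture:
  assumes X: "\<And>k. k \<in> I \<Longrightarrow> prob_space (M k)" "\<And>k. k \<in> I \<Longrightarrow> X k \<in> borel_measurable (M k)"
    and p: "\<And>k. k \<in> I \<Longrightarrow> 0 \<le> p k" "sum p I = 1"
    and mix: "drawn_from_mixture I p M X N Y"
  shows "Re (char_fn N Y t) = (\<Sum>k\<in>I. p k * Re (char_fn (M k) (X k) t))"
proof -
  have Y: "prob_space N" "Y \<in> borel_measurable N"
    using mix by (auto simp: drawn_from_mixture_def)
  \<comment> \<open>The definition of a mixture speaks of real-valued \<open>measure\<close>;
    finiteness of the laws and nonnegative weights lift it to \<open>emeasure\<close>.\<close>
  have em: "emeasure (distr N borel Y) A = (\<Sum>k\<in>I. ennreal (p k) * emeasure (distr (M k) borel (X k)) A)"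
    if "A \<in> sets (distr N borel Y)" for A
  proof -
    have "emeasure (distr N borel Y) A = ennreal (\<Sum>k\<in>I. p k * measure (distr (M k) borel (X k)) A)"
      using that mix Y by (simp add: drawn_from_mixture_def finite_measure.emeasure_eq_measure
          prob_space.finite_measure prob_space.prob_space_distr)
    also have "\<dots> = (\<Sum>k\<in>I. ennreal (p k * measure (distr (M k) borel (X k)) A))"
      by (intro sum_ennreal[symmetric]) (simp add: p)
    also have "\<dots> = (\<Sum>k\<in>I. ennreal (p k) * emeasure (distr (M k) borel (X k)) A)"
      by (intro sum.cong refl) (simp add: p X ennreal_mult finite_measure.emeasure_eq_measure
          prob_space.finite_measure prob_space.prob_space_distr)
    finally show ?thesis .
  qed
  have "ennreal (1 + Re (char_fn N Y t)) = (\<integral>\<^sup>+x. ennreal (1 + cos (t * x)) \<partial>distr N borel Y)"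
    by (simp add: nn_integral_one_plus_cos[OF Y])
  also have "\<dots> = (\<Sum>k\<in>I. ennreal (p k) *
      (\<integral>\<^sup>+x. ennreal (1 + cos (t * x)) \<partial>distr (M k) borel (X k)))"
    by (intro nn_integral_mixture em) auto
  also have "\<dots> = (\<Sum>k\<in>I. ennreal (p k * (1 + Re (char_fn (M k) (X k) t))))"
    by (intro sum.cong refl)
      (simp add: nn_integral_one_plus_cos X p ennreal_mult one_plus_Re_char_fn_nonneg)
  also have "\<dots> = ennreal (\<Sum>k\<in>I. p k * (1 + Re (char_fn (M k) (X k) t)))"
    by (intro sum_ennreal mult_nonneg_nonneg p one_plus_Re_char_fn_nonneg X)
  \<comment> \<open>Both sides are nonnegative, so \<open>ennreal\<close> is injective on
    them.\<close>
  finally have "1 + Re (char_fn N Y t) = (\<Sum>k\<in>I. p k * (1 + Re (char_fn (M k) (X k) t)))"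
    by (subst (asm) ennreal_inj)
      (auto intro!: sum_nonneg mult_nonneg_nonneg p one_plus_Re_char_fn_nonneg X Y)
  then show ?thesis
    by (simp add: distrib_left sum.distrib p(2))
qed

lemma char_fn_scale:
  assumes "X \<in> borel_measurable M"
  shows "char_fn M (\<lambda>\<omega>. w * X \<omega>) t = char_fn M X (t * w)"
  using assms by (simp add: char_fn_eq_expectation mult.assoc)

text \<open>The cosine is even. This reduces negative \<open>\<theta>\<close> to the behaviour at
  plus infinity, where the decay hypothesis lives.\<close>

lemma Re_char_fn_abs:
  assumes "prob_space M" "X \<in> borel_measurable M"
  shows "Re (char_fn M X \<bar>t\<bar>) = Re (char_fn M X t)"
  using assms by (simp add: Re_char_fn abs_if)

theorem proposition8:
  fixes \<theta> :: real and n :: nat and p :: "nat \<Rightarrow> real"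
    and M :: "nat \<Rightarrow> 'a measure" and X :: "nat \<Rightarrow> 'a \<Rightarrow> real"
    and N :: "'b measure" and Y :: "'b \<Rightarrow> real"
  assumes "\<theta> \<noteq> 0"
    and "\<And>k. k \<in> {1..n} \<Longrightarrow> class_D (M k) (X k)"
    and "\<And>k. k \<in> {1..n} \<Longrightarrow> p k > 0"
    and "(\<Sum>k\<in>{1..n}. p k) = 1"
    and "drawn_from_mixture {1..n} p M X N Y"
    and "\<And>k. k \<in> {1..n} \<Longrightarrow> k > 1 \<Longrightarrow>
           char_fn (M k) (X k) \<in> o[at_top](char_fn (M 1) (X 1))"
  shows "((\<lambda>w::real. log_char \<theta> N (\<lambda>\<omega>. w * Y \<omega>) - log_char \<theta> (M 1) (\<lambda>\<omega>. w * X 1 \<omega>))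
            \<longlongrightarrow> - (2 / \<theta>\<^sup>2) * ln (p 1)) at_top"
proof -
  define r where "r k t = Re (char_fn (M k) (X k) t)" for k t
  define s where "s t = Re (char_fn N Y t)" for t
  \<comment> \<open>For \<open>n = 0\<close> the weights would sum to 0.\<close>
  have n: "1 \<in> {1..n}"
    using assms(4) by (cases n) auto
  have M: "prob_space (M k)" and X: "X k \<in> borel_measurable (M k)" if "k \<in> {1..n}" for k
    using assms(2)[OF that] by (auto simp: class_D_def)
  have N: "prob_space N" and Y: "Y \<in> borel_measurable N"
    using assms(5) by (auto simp: drawn_from_mixture_def)
  \<comment> \<open>Membership in the class makes each component characteristic function real and
    positive, so the quotients below can be taken in the reals.\<close>
  have char_r: "char_fn (M k) (X k) t = of_real (r k t)" and r_pos: "r k t > 0"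
    if "k \<in> {1..n}" for k t
    using class_D_char_fn_pos[OF assms(2)[OF that], of t] by (auto simp: r_def)
  have s: "s t = (\<Sum>k\<in>{1..n}. p k * r k t)" for t
    unfolding s_def r_def using assms(3-5) M X by (intro Re_char_fn_mixture) (auto intro: less_imp_le)
  have s_pos: "s t > 0" for t
    unfolding s using n assms(3) r_pos by (intro sum_pos mult_pos_pos) auto
  have ratio: "((\<lambda>t. r k t / r 1 t) \<longlongrightarrow> (if k = 1 then 1 else 0)) at_top" if k: "k \<in> {1..n}" for k
  proof (cases "k = 1")
    case True
    then show ?thesis using r_pos[OF n] by (simp add: less_imp_neq[symmetric])
  next
    case False
    then have "((\<lambda>t. char_fn (M k) (X k) t / char_fn (M 1) (X 1) t) \<longlongrightarrow> 0) at_top"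
      using k by (intro smalloD_tendsto assms(6)) auto
    \<comment> \<open>The little-o hypothesis concerns complex functions; its limit descends to the
      reals through the embedding.\<close>
    then have "((\<lambda>t. complex_of_real (r k t / r 1 t)) \<longlongrightarrow> of_real 0) at_top"
      using char_r[OF k] char_r[OF n] by simp
    then show ?thesis
      using False by (simp only: tendsto_of_real_iff if_False)
  qed
  have "((\<lambda>t. \<Sum>k\<in>{1..n}. p k * (r k t / r 1 t)) \<longlongrightarrow>
      (\<Sum>k\<in>{1..n}. p k * (if k = 1 then 1 else 0))) at_top"
    by (intro tendsto_sum tendsto_mult_left ratio)
  \<comment> \<open>Only the summand \<open>k = 1\<close> survives in the limit.\<close>
  then have "((\<lambda>t. s t / r 1 t) \<longlongrightarrow> p 1) at_top"
    using n by (simp add: s sum_divide_distrib if_distrib cong: if_cong)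
  moreover have "filterlim (\<lambda>w. \<bar>\<theta>\<bar> * w) at_top at_top"
    using assms(1) by (intro filterlim_tendsto_pos_mult_at_top[OF tendsto_const]) (auto simp: filterlim_ident)
  ultimately have "((\<lambda>w. s (\<bar>\<theta>\<bar> * w) / r 1 (\<bar>\<theta>\<bar> * w)) \<longlongrightarrow> p 1) at_top"
    by (rule filterlim_compose)
  then have lim: "((\<lambda>w. - (2 / \<theta>\<^sup>2) * ln (s (\<bar>\<theta>\<bar> * w) / r 1 (\<bar>\<theta>\<bar> * w)))
      \<longlongrightarrow> - (2 / \<theta>\<^sup>2) * ln (p 1)) at_top"
    using assms(3)[OF n] by (intro tendsto_mult_left tendsto_ln) auto
  \<comment> \<open>For \<open>w \<ge> 0\<close> the point \<open>\<bar>\<theta>\<bar> * w\<close>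
    equals \<open>\<bar>\<theta> * w\<bar>\<close>, so evenness applies; nonnegative
    \<open>w\<close> suffice for a limit at plus infinity.\<close>
  have "log_char \<theta> N (\<lambda>\<omega>. w * Y \<omega>) - log_char \<theta> (M 1) (\<lambda>\<omega>. w * X 1 \<omega>) =
      - (2 / \<theta>\<^sup>2) * ln (s (\<bar>\<theta>\<bar> * w) / r 1 (\<bar>\<theta>\<bar> * w))" if "w \<ge> 0" for w
  proof -
    have w: "\<bar>\<theta>\<bar> * w = \<bar>\<theta> * w\<bar>"
      using that by (simp add: abs_mult)
    have "log_char \<theta> N (\<lambda>\<omega>. w * Y \<omega>) = - (2 / \<theta>\<^sup>2) * ln (s (\<bar>\<theta>\<bar> * w))"
      "log_char \<theta> (M 1) (\<lambda>\<omega>. w * X 1 \<omega>) = - (2 / \<theta>\<^sup>2) * ln (r 1 (\<bar>\<theta>\<bar> * w))"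
      by (simp_all only: w log_char_def s_def r_def char_fn_scale[OF Y] char_fn_scale[OF X[OF n]]
          Re_char_fn_abs[OF N Y] Re_char_fn_abs[OF M[OF n] X[OF n]])
    \<comment> \<open>Positivity of \<open>s\<close> and \<open>r 1\<close> justifies turning the
      difference of logarithms into the logarithm of the quotient.\<close>
    then show ?thesis
      using s_pos[of "\<bar>\<theta>\<bar> * w"] r_pos[OF n, of "\<bar>\<theta>\<bar> * w"]
      by (simp add: ln_div right_diff_distrib)
  qed
  then have "\<forall>\<^sub>F w in at_top. - (2 / \<theta>\<^sup>2) * ln (s (\<bar>\<theta>\<bar> * w) / r 1 (\<bar>\<theta>\<bar> * w)) =
      log_char \<theta> N (\<lambda>\<omega>. w * Y \<omega>) - log_char \<theta> (M 1) (\<lambda>\<omega>. w * X 1 \<omega>)"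
    by (intro eventually_mono[OF eventually_ge_at_top[of 0]]) simp
  with lim show ?thesis
    by (rule Lim_transform_eventually)
qed

end
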